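(* Let $\mathcal{H}=\{C_6,C_6^1,C_6^2,C_6^3\}$, let $G$ be a graph containing no member of $\mathcal{H}$ as an induced subgraph, and let $G^*$ be its auxiliary graph. If $k(G^* )=\alpha(G^* )$, then $\chi_{cd}(G)=\omega_s(G)$. Consequently, if $G$ contains no member of $\mathcal{H}$ as an induced subgraph and $G^*$ is perfect, then $\chi_{cd}(G)=\omega_s(G)$.
   Context: Graphs are finite, simple, undirected. $C_6$ is the cycle on six vertices; its vertex set splits into two independent sets $A,B$ of size $3$. $C_6^1$, $C_6^2$, $C_6^3$ denote the graphs obtained from $C_6$ by adding respectively $1$, $2$, $3$ edges between vertices of one of the sets $A$ (only inside one part). The auxiliary graph $G^*$ has vertex set $V(G)$, and $uv$ is an edge of $G^*$ iff $d_G(u,v)=2$. $\alpha$ is the independence number and $k$ the clique cover number (minimum number of cliques partitioning the vertex set). A cd-colouring of $G$ is a proper colouring in which every colour class $C$ satisfies $C\subseteq N_G[v]$ for some vertex $v$ (for classes of size at least 2 this means $C\subseteq N_G(v)$; singleton classes are always allowed); $\chi_{cd}(G)$ is the minimum number of colours in a cd-colouring. A separated-cluster is a set $S\subseteq V(G)$ with no two vertices at distance exactly $2$ in $G$; $\omega_s(G)$ is the maximum size of a separated-cluster. *)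

theory Defs
  imports "Graph_Theory.Graph_Theory" "HOL-Library.Disjoint_Sets"
begin

text \<open>
  A finite simple undirected graph is a symmetric, loop-free digraph without parallel arcs
  (locale \<open>graph\<close>); each edge is a pair of opposite arcs.
\<close>

section \<open>Distance and the auxiliary graph\<close>

text \<open>
  The number of edges on a shortest walk, and \<open>\<infinity>\<close> if there is none. The constant \<open>wf_digraph.\<mu>\<close>
  is specified only for well-formed \<open>G\<close>.
\<close>

definition graph_dist :: "('a, 'b) pre_digraph \<Rightarrow> 'a \<Rightarrow> 'a \<Rightarrow> ereal" where
  "graph_dist G u v = wf_digraph.\<mu> G (\<lambda>_. 1) u v"

definition auxiliary_graph :: "('a, 'b) pre_digraph \<Rightarrow> ('a, 'a \<times> 'a) pre_digraph" where
  "auxiliary_graph G = with_proj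
     \<lparr> pverts = verts G,
       parcs = {(u, v). u \<in> verts G \<and> v \<in> verts G \<and> graph_dist G u v = 2} \<rparr>"

definition separated_cluster :: "('a, 'b) pre_digraph \<Rightarrow> 'a set \<Rightarrow> bool" where
  "separated_cluster G S \<longleftrightarrow> S \<subseteq> verts G \<and> (\<forall>u\<in>S. \<forall>v\<in>S. graph_dist G u v \<noteq> 2)"

definition separated_cluster_number :: "('a, 'b) pre_digraph \<Rightarrow> nat" where
  "separated_cluster_number G = Max (card ` {S. separated_cluster G S})"


section \<open>Independent sets and cliques\<close>

definition independent_set :: "('a, 'b) pre_digraph \<Rightarrow> 'a set \<Rightarrow> bool" where
  "independent_set G S \<longleftrightarrow> S \<subseteq> verts G \<and> (\<forall>u\<in>S. \<forall>v\<in>S. \<not> u \<rightarrow>\<^bsub>G\<^esub> v)"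

definition clique :: "('a, 'b) pre_digraph \<Rightarrow> 'a set \<Rightarrow> bool" where
  "clique G S \<longleftrightarrow> S \<subseteq> verts G \<and> (\<forall>u\<in>S. \<forall>v\<in>S. u \<noteq> v \<longrightarrow> u \<rightarrow>\<^bsub>G\<^esub> v)"

definition independence_number :: "('a, 'b) pre_digraph \<Rightarrow> nat" where
  "independence_number G = Max (card ` {S. independent_set G S})"

definition clique_number :: "('a, 'b) pre_digraph \<Rightarrow> nat" where
  "clique_number G = Max (card ` {S. clique G S})"

definition clique_cover_number :: "('a, 'b) pre_digraph \<Rightarrow> nat" where
  "clique_cover_number G =
     (LEAST n. \<exists>P. partition_on (verts G) P \<and> (\<forall>C\<in>P. clique G C) \<and> card P = n)"


section \<open>Colourings\<close>

definition proper_colouring :: "('a, 'b) pre_digraph \<Rightarrow> ('a \<Rightarrow> nat) \<Rightarrow> bool" where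
  "proper_colouring G c \<longleftrightarrow> (\<forall>u v. u \<rightarrow>\<^bsub>G\<^esub> v \<longrightarrow> c u \<noteq> c v)"

definition chromatic_number :: "('a, 'b) pre_digraph \<Rightarrow> nat" where
  "chromatic_number G = (LEAST n. \<exists>c. proper_colouring G c \<and> card (c ` verts G) = n)"

definition perfect_graph :: "('a, 'b) pre_digraph \<Rightarrow> bool" where
  "perfect_graph G \<longleftrightarrow> (\<forall>H. induced_subgraph H G \<longrightarrow> chromatic_number H = clique_number H)"

definition colour_class :: "('a, 'b) pre_digraph \<Rightarrow> ('a \<Rightarrow> nat) \<Rightarrow> nat \<Rightarrow> 'a set" where
  "colour_class G c i = {v \<in> verts G. c v = i}"

definition closed_neighbourhood :: "('a, 'b) pre_digraph \<Rightarrow> 'a \<Rightarrow> 'a set" where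
  "closed_neighbourhood G v = insert v {u. v \<rightarrow>\<^bsub>G\<^esub> u}"

text \<open>
  For a colour class with at least two elements, properness makes
  \<open>colour_class G c i \<subseteq> closed_neighbourhood G v\<close> equivalent to containment in the open
  neighbourhood of \<open>v\<close>; singleton classes always satisfy it.
\<close>

definition cd_colouring :: "('a, 'b) pre_digraph \<Rightarrow> ('a \<Rightarrow> nat) \<Rightarrow> bool" where
  "cd_colouring G c \<longleftrightarrow> proper_colouring G c \<and>
     (\<forall>i \<in> c ` verts G. \<exists>v \<in> verts G. colour_class G c i \<subseteq> closed_neighbourhood G v)"

definition cd_chromatic_number :: "('a, 'b) pre_digraph \<Rightarrow> nat" where
  "cd_chromatic_number G = (LEAST n. \<exists>c. cd_colouring G c \<and> card (c ` verts G) = n)"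


section \<open>Forbidden induced subgraphs\<close>

definition contains_induced :: "('a, 'b) pre_digraph \<Rightarrow> ('c, 'd) pre_digraph \<Rightarrow> bool" where
  "contains_induced G F \<longleftrightarrow> (\<exists>H. induced_subgraph H G \<and> digraph_iso H F)"

definition C6_edges :: "(nat \<times> nat) set" where
  "C6_edges = {(0,1), (1,2), (2,3), (3,4), (4,5), (5,0)}"

definition C6_with :: "(nat \<times> nat) set \<Rightarrow> (nat, nat \<times> nat) pre_digraph" where
  "C6_with E = with_proj
     \<lparr> pverts = {0, 1, 2, 3, 4, 5}, parcs = (C6_edges \<union> E) \<union> (C6_edges \<union> E)\<inverse> \<rparr>"

text \<open>
  The added edges lie inside the part \<open>{0, 2, 4}\<close>. Every permutation of \<open>{0, 2, 4}\<close>
  extends to an automorphism of the 6-cycle, and so does a swap of the two parts, so up to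
  isomorphism only the number of added edges matters.
\<close>

definition forbidden_graphs :: "(nat, nat \<times> nat) pre_digraph set" where
  "forbidden_graphs =
     {C6_with {}, C6_with {(0,2)}, C6_with {(0,2), (2,4)}, C6_with {(0,2), (2,4), (4,0)}}"


section \<open>Well-formedness\<close>

lemma graph_dist_eq_2_iff:
  assumes "graph G"
  shows "graph_dist G u v = 2 \<longleftrightarrow>
    u \<noteq> v \<and> \<not> u \<rightarrow>\<^bsub>G\<^esub> v \<and> (\<exists>w. u \<rightarrow>\<^bsub>G\<^esub> w \<and> w \<rightarrow>\<^bsub>G\<^esub> v)"
proof -
  interpret graph G by fact
  have cost: "awalk_cost (\<lambda>_. 1) p = real (length p)" for p :: "'b list"
    by (induction p) (auto simp: awalk_cost_def)
  have dist: "graph_dist G u v = (INF p\<in>{p. awalk u p v}. ereal (real (length p)))"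
    by (simp add: graph_dist_def \<mu>_def cost)
  have w0: "awalk u [] v \<longleftrightarrow> u = v \<and> u \<in> verts G"
    by (auto simp: awalk_Nil_iff)
  have w1: "(\<exists>e. awalk u [e] v) \<longleftrightarrow> u \<rightarrow>\<^bsub>G\<^esub> v"
    by (auto simp: awalk_Cons_iff awalk_Nil_iff arcs_ends_conv intro: rev_image_eqI)
  have w2: "(\<exists>e f. awalk u [e, f] v) \<longleftrightarrow> (\<exists>w. u \<rightarrow>\<^bsub>G\<^esub> w \<and> w \<rightarrow>\<^bsub>G\<^esub> v)"
    by (fastforce simp: awalk_Cons_iff awalk_Nil_iff arcs_ends_conv intro: rev_image_eqI)
  show ?thesis
  proof
    assume d: "graph_dist G u v = 2"
    then have ge: "2 \<le> length p" if "awalk u p v" for p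
    proof -
      have "graph_dist G u v \<le> ereal (real (length p))"
        unfolding dist by (rule INF_lower) (use that in auto)
      then show ?thesis using d by simp
    qed
    have "(INF p\<in>{p. awalk u p v}. ereal (real (length p))) < 3"
      using d unfolding dist by simp
    then obtain p where p: "awalk u p v" "length p < 3"
      unfolding INF_less_iff by auto
    with ge[OF p(1)] obtain e f where "p = [e, f]"
      by (cases p; cases "tl p") auto
    with p w2 have "\<exists>w. u \<rightarrow>\<^bsub>G\<^esub> w \<and> w \<rightarrow>\<^bsub>G\<^esub> v" by blast
    moreover have "u \<noteq> v"
      using ge[of "[]"] w0 p(1) by auto
    moreover have "\<not> u \<rightarrow>\<^bsub>G\<^esub> v"
      using ge w1 by force
    ultimately show "u \<noteq> v \<and> \<not> u \<rightarrow>\<^bsub>G\<^esub> v \<and> (\<exists>w. u \<rightarrow>\<^bsub>G\<^esub> w \<and> w \<rightarrow>\<^bsub>G\<^esub> v)" by blast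
  next
    assume a: "u \<noteq> v \<and> \<not> u \<rightarrow>\<^bsub>G\<^esub> v \<and> (\<exists>w. u \<rightarrow>\<^bsub>G\<^esub> w \<and> w \<rightarrow>\<^bsub>G\<^esub> v)"
    have ge: "2 \<le> length p" if "awalk u p v" for p
    proof (rule ccontr)
      assume "\<not> 2 \<le> length p"
      then have "p = [] \<or> (\<exists>e. p = [e])" by (cases p; cases "tl p") auto
      then show False using that a w0 w1 by blast
    qed
    obtain e f where ef: "awalk u [e, f] v" using a w2 by blast
    show "graph_dist G u v = 2"
      unfolding dist
    proof (rule antisym)
      show "(INF p\<in>{p. awalk u p v}. ereal (real (length p))) \<le> 2"
        using ef by (intro INF_lower2[of "[e, f]"]) auto
      show "2 \<le> (INF p\<in>{p. awalk u p v}. ereal (real (length p)))"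
        using ge by (intro INF_greatest) auto
    qed
  qed
qed

lemma graph_auxiliary_graph:
  assumes "graph G"
  shows "graph (auxiliary_graph G)"
proof -
  interpret graph G by fact
  have sym: "u \<rightarrow>\<^bsub>G\<^esub> v \<longleftrightarrow> v \<rightarrow>\<^bsub>G\<^esub> u" for u v
    using sym_arcs by (auto simp: symmetric_def dest: symD)
  have dsym: "graph_dist G u v = 2 \<longleftrightarrow> graph_dist G v u = 2" for u v
    unfolding graph_dist_eq_2_iff[OF assms] using sym by blast
  have irrefl: "graph_dist G u u \<noteq> 2" for u
    unfolding graph_dist_eq_2_iff[OF assms] by blast
  have "pair_graph \<lparr> pverts = verts G,
      parcs = {(u, v). u \<in> verts G \<and> v \<in> verts G \<and> graph_dist G u v = 2} \<rparr>"
    (is "pair_graph ?A")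
  proof unfold_locales
    show "finite (parcs ?A)"
      by (rule finite_subset[of _ "verts G \<times> verts G"]) auto
    show "symmetric (with_proj ?A)"
      unfolding symmetric_def with_proj_simps using dsym by (auto intro!: symI)
  qed (use irrefl in auto)
  then interpret A: pair_graph ?A .
  show ?thesis
    unfolding auxiliary_graph_def by unfold_locales
qed

lemma graph_forbidden_graphs:
  assumes "F \<in> forbidden_graphs"
  shows "graph F"
proof -
  have "graph (C6_with E)" if E: "E \<subseteq> {(0,2), (2,4), (4,0)}" for E
  proof -
    let ?A = "\<lparr> pverts = {0, 1, 2, 3, 4, 5 :: nat},
        parcs = (C6_edges \<union> E) \<union> (C6_edges \<union> E)\<inverse> \<rparr>"
    have fin: "finite (parcs ?A)"
      using finite_subset[OF E] by (auto simp: C6_edges_def)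
    have vs: "fst e \<in> pverts ?A \<and> snd e \<in> pverts ?A \<and> fst e \<noteq> snd e" if "e \<in> parcs ?A" for e
      using that E unfolding C6_edges_def by fastforce
    have "pair_graph ?A"
      using fin vs by unfold_locales (blast | simp add: symmetric_def sym_Un_converse)+
    then interpret A: pair_graph ?A .
    show ?thesis
      unfolding C6_with_def by unfold_locales
  qed
  then show ?thesis using assms by (auto simp: forbidden_graphs_def)
qed

end

theory Submission
  imports Defs
begin

text \<open>
  Colour classes of a cd-colouring of \<open>G\<close> are cliques of \<open>G\<^sup>*\<close>. Conversely, if \<open>G\<close> has no forbidden
  induced subgraph, then cliques of \<open>G\<^sup>*\<close> have a Helly property: pairwise common neighbours yield
  one neighbour common to all. Hence \<open>\<chi>\<^sub>c\<^sub>d(G) = k(G\<^sup>*)\<close>, while \<open>\<omega>\<^sub>s(G) = \<alpha>(G\<^sup>*)\<close> always holds. For the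
  second part, perfection of \<open>G\<^sup>*\<close> gives \<open>k(G\<^sup>*) = \<alpha>(G\<^sup>*)\<close> by Lovasz's weak perfect graph theorem: if
  every clique missed some maximum independent set, weighting each vertex by the number of chosen
  sets containing it would contradict the replication lemma.
\<close>

section \<open>Cliques, independent sets and colourings\<close>

lemma (in graph) dominates_sym: "u \<rightarrow>\<^bsub>G\<^esub> v \<longleftrightarrow> v \<rightarrow>\<^bsub>G\<^esub> u"
  using sym_arcs by (auto simp: symmetric_def dest: symD)

lemma (in graph) not_dominates_self: "\<not> u \<rightarrow>\<^bsub>G\<^esub> u"
  using adj_not_same by blast

lemma finite_clique: "finite (verts G) \<Longrightarrow> clique G K \<Longrightarrow> finite K"
  unfolding clique_def using finite_subset by blast

lemma finite_cliques: "finite (verts G) \<Longrightarrow> finite {K. clique G K}"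
  by (rule finite_subset[of _ "Pow (verts G)"]) (auto simp: clique_def)

lemma finite_independent_sets: "finite (verts G) \<Longrightarrow> finite {S. independent_set G S}"
  by (rule finite_subset[of _ "Pow (verts G)"]) (auto simp: independent_set_def)

lemma independent_set_empty: "independent_set G {}"
  by (simp add: independent_set_def)

lemma clique_empty: "clique G {}"
  by (simp add: clique_def)

lemma independent_set_subset: "independent_set G S \<Longrightarrow> T \<subseteq> S \<Longrightarrow> independent_set G T"
  unfolding independent_set_def by blast

lemma card_independent_set_le:
  "finite (verts G) \<Longrightarrow> independent_set G S \<Longrightarrow> card S \<le> independence_number G"
  unfolding independence_number_def by (intro Max_ge) (auto simp: finite_independent_sets)

lemma independence_number_attained:
  assumes "finite (verts G)"
  obtains S where "independent_set G S" "card S = independence_number G"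
proof -
  have "independence_number G \<in> card ` {S. independent_set G S}"
    unfolding independence_number_def using assms independent_set_empty
    by (intro Max_in) (auto simp: finite_independent_sets)
  then show thesis using that by auto
qed

lemma clique_number_attained:
  assumes "finite (verts G)"
  obtains K where "clique G K" "card K = clique_number G"
proof -
  have "clique_number G \<in> card ` {K. clique G K}"
    unfolding clique_number_def using assms clique_empty
    by (intro Max_in) (auto simp: finite_cliques)
  then show thesis using that by auto
qed

lemma card_clique_Int_independent_set_le_1:
  assumes "clique G K" "independent_set G S"
  shows "card (K \<inter> S) \<le> 1"
proof -
  have "a = b" if "a \<in> K \<inter> S" "b \<in> K \<inter> S" for a b
    using assms that unfolding clique_def independent_set_def by blast
  then have "K \<inter> S = {} \<or> (\<exists>a. K \<inter> S = {a})" by blast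
  then show ?thesis by auto
qed

text \<open>A clique holds at most one vertex of \<open>S\<close>, so choosing a part around every
  vertex of \<open>S\<close> is injective. This is the inequality between \<alpha> and
  \<open>k\<close> valid in every graph.\<close>

lemma (in graph) independence_le_clique_cover:
  assumes S: "independent_set G S" and P: "partition_on (verts G) P" "\<forall>C\<in>P. clique G C"
  shows "card S \<le> card P"
proof -
  have fP: "finite P" using finite_elements[OF finite_verts P(1)] .
  have "\<forall>v\<in>S. \<exists>C. C \<in> P \<and> v \<in> C"
    using S P(1) unfolding independent_set_def partition_on_def by blast
  then obtain f where f: "\<forall>v\<in>S. f v \<in> P \<and> v \<in> f v" by metis
  have "inj_on f S"
    using f P(2) S unfolding inj_on_def clique_def independent_set_def by metis
  then show ?thesis using f fP by (intro card_inj_on_le[of f]) auto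
qed

lemma clique_cover_number_le:
  "partition_on (verts G) P \<Longrightarrow> \<forall>C\<in>P. clique G C \<Longrightarrow> clique_cover_number G \<le> card P"
  unfolding clique_cover_number_def by (rule Least_le) blast

lemma clique_cover_number_attained:
  obtains P where "partition_on (verts G) P" "\<forall>C\<in>P. clique G C" "card P = clique_cover_number G"
proof -
  \<comment> \<open>The partition into singletons shows that the minimum ranges over a nonempty
    set.\<close>
  let ?P = "(\<lambda>v. {v}) ` verts G"
  have "partition_on (verts G) ?P" "\<forall>C\<in>?P. clique G C"
    by (auto simp: partition_on_def disjoint_def clique_def)
  then have "\<exists>n P. partition_on (verts G) P \<and> (\<forall>C\<in>P. clique G C) \<and> card P = n" by blast
  from LeastI_ex[OF this] show thesis
    using that unfolding clique_cover_number_def by blast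
qed

lemma (in graph) chromatic_number_attained:
  obtains c where "proper_colouring G c" "card (c ` verts G) = chromatic_number G"
proof -
  obtain c :: "'a \<Rightarrow> nat" where c: "inj_on c (verts G)"
    using finite_imp_inj_to_nat_seg[OF finite_verts] by blast
  have "proper_colouring G c"
    unfolding proper_colouring_def
    using c adj_in_verts not_dominates_self by (metis inj_on_eq_iff)
  then have "\<exists>n c. proper_colouring G c \<and> card (c ` verts G) = n" by blast
  from LeastI_ex[OF this] show thesis
    using that unfolding chromatic_number_def by blast
qed

section \<open>The weak perfect graph theorem\<close>

text \<open>Perfection read inside \<open>G\<close>: adjacency on \<open>W\<close> agrees with that
  of the induced subgraph, so the cliques of the latter are cliques of \<open>G\<close> and its
  clique number, hence its chromatic number, is at most \<open>m\<close>.\<close>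

lemma (in graph) perfect_induced_colouring:
  assumes "perfect_graph G" "W \<subseteq> verts G"
    and m: "\<And>K. clique G K \<Longrightarrow> K \<subseteq> W \<Longrightarrow> card K \<le> m"
  shows "\<exists>c :: 'a \<Rightarrow> nat. (\<forall>u\<in>W. \<forall>v\<in>W. u \<rightarrow>\<^bsub>G\<^esub> v \<longrightarrow> c u \<noteq> c v) \<and> card (c ` W) \<le> m"
proof -
  let ?H = "G \<restriction> W"
  have ind: "induced_subgraph ?H G" using assms(2) by (rule induced_induce)
  then have "digraph ?H" "sym_digraph ?H" by (rule digraphI_induced induced_graph_imp_graph)+
  then interpret H: graph ?H
    by (simp add: graph_def pseudo_graph_def digraph_def fin_digraph_def sym_digraph_def)
  have dom: "u \<rightarrow>\<^bsub>?H\<^esub> v \<longleftrightarrow> u \<rightarrow>\<^bsub>G\<^esub> v" if "u \<in> W" "v \<in> W" for u v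
    using that by (auto simp: arcs_ends_conv)
  obtain c where c: "proper_colouring ?H c" "card (c ` verts ?H) = chromatic_number ?H"
    by (rule H.chromatic_number_attained)
  obtain K where K: "clique ?H K" "card K = clique_number ?H"
    using clique_number_attained[OF H.finite_verts] by blast
  have "clique G K" "K \<subseteq> W"
    using K(1) dom assms(2) unfolding clique_def by (auto simp: subset_iff)
  then have "card (c ` W) \<le> m"
    using m[of K] K(2) c(2) ind assms(1) unfolding perfect_graph_def by auto
  moreover have "c u \<noteq> c v" if "u \<in> W" "v \<in> W" "u \<rightarrow>\<^bsub>G\<^esub> v" for u v
    using c(1) that dom unfolding proper_colouring_def by blast
  ultimately show ?thesis by blast
qed

text \<open>Double counting of incidences between points of \<open>K\<close> and entries of the
  list.\<close>

lemma sum_sum_list_of_bool: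
  fixes Ls :: "'a set list"
  assumes "finite K"
  shows "(\<Sum>v\<in>K. \<Sum>S\<leftarrow>Ls. of_bool (v \<in> S)) = (\<Sum>S\<leftarrow>Ls. card (K \<inter> S))"
  using assms by (induction Ls) (simp_all add: sum.distrib flip: sum.inter_restrict)

text \<open>
  This is the replication lemma: \<open>h v\<close> is the number of copies of \<open>v\<close>, and the independent sets
  are the colour classes of the blown-up graph.
\<close>

lemma (in graph) perfect_weighted_colouring:
  fixes h :: "'a \<Rightarrow> nat"
  assumes perf: "perfect_graph G" and "\<And>K. clique G K \<Longrightarrow> sum h K \<le> m"
  shows "\<exists>Ls. length Ls \<le> m \<and> (\<forall>S\<in>set Ls. independent_set G S) \<and>
    (\<forall>v\<in>verts G. (\<Sum>S\<leftarrow>Ls. of_bool (v \<in> S)) = h v)"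
  using assms(2)
\<comment> \<open>Induction on the number of vertices of the blow-up. The bound \<open>m\<close>
  must vary: the induction hypothesis is used first with \<open>m\<close>, then with
  \<open>m - 1\<close>.\<close>
proof (induction "sum h (verts G)" arbitrary: h m rule: less_induct)
  case less
  show ?case
  proof (cases "\<forall>v\<in>verts G. h v \<le> 1")
    case True
    \<comment> \<open>With weights 0 and 1 the blow-up is the subgraph induced on \<open>W\<close>,
      so perfection applies directly.\<close>
    define W where "W = {v\<in>verts G. h v = 1}"
    have W: "W \<subseteq> verts G" by (auto simp: W_def)
    have bound: "card K \<le> m" if "clique G K" "K \<subseteq> W" for K
    proof -
      have "sum h K = card K" using that(2) by (auto simp: W_def subset_iff)
      then show ?thesis using less.prems[OF that(1)] by simp
    qed
    obtain c :: "'a \<Rightarrow> nat" where c: "\<And>u v. u \<in> W \<Longrightarrow> v \<in> W \<Longrightarrow> u \<rightarrow>\<^bsub>G\<^esub> v \<Longrightarrow> c u \<noteq> c v"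
        "card (c ` W) \<le> m"
      using perfect_induced_colouring[OF perf W bound] by metis
    have fin: "finite (c ` W)" by (simp add: W_def)
    let ?Ls = "map (\<lambda>i. {v\<in>W. c v = i}) (sorted_list_of_set (c ` W))"
    have "(\<Sum>S\<leftarrow>?Ls. of_bool (v \<in> S)) = h v" if "v \<in> verts G" for v
    proof -
      have "(\<Sum>S\<leftarrow>?Ls. of_bool (v \<in> S)) = (\<Sum>i\<in>c ` W. of_bool (v \<in> W \<and> c v = i) :: nat)"
        using fin by (simp add: o_def sum_list_distinct_conv_sum_set)
      also have "\<dots> = of_bool (v \<in> W)"
        using fin by (cases "v \<in> W") (auto simp: of_bool_def sum.delta)
      also have "\<dots> = h v" using that True by (auto simp: W_def le_Suc_eq)
      finally show ?thesis .
    qed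
    moreover have "independent_set G S" if S_in: "S \<in> set ?Ls" for S
    proof -
      obtain i where S: "S = {v\<in>W. c v = i}" using S_in by auto
      have "\<not> u \<rightarrow>\<^bsub>G\<^esub> v" if "u \<in> S" "v \<in> S" for u v
        using c(1)[of u v] that by (metis (mono_tags, lifting) S mem_Collect_eq)
      then show ?thesis using W unfolding independent_set_def S by blast
    qed
    ultimately show ?thesis
      using c(2) by (intro exI[of _ ?Ls]) auto
  next
    case False
    then obtain x where x: "x \<in> verts G" "h x \<ge> 2" by force
    \<comment> \<open>One copy of \<open>x\<close> is dropped and the rest is covered by at most
      \<open>m\<close> independent sets. Another copy of \<open>x\<close> remains, so one of these
      sets, \<open>S\<close>, contains \<open>x\<close>.\<close>
    define h' where "h' = h(x := h x - 1)"
    have le: "h' v \<le> h v" for v by (simp add: h'_def)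
    have lt: "sum h' K < sum h K" if "x \<in> K" "finite K" for K
      using that x(2) le by (intro sum_strict_mono_ex1) (auto simp: h'_def)
    have "sum h' K \<le> m" if "clique G K" for K
      using sum_mono[of K h' h] le less.prems[OF that] by fastforce
    from less.hyps[OF lt[OF x(1) finite_verts] this]
    obtain Ls where Ls: "length Ls \<le> m" "\<And>S. S \<in> set Ls \<Longrightarrow> independent_set G S"
        "\<And>v. v \<in> verts G \<Longrightarrow> (\<Sum>S\<leftarrow>Ls. of_bool (v \<in> S)) = h' v"
      by blast
    have "(\<Sum>S\<leftarrow>Ls. of_bool (x \<in> S) :: nat) \<noteq> 0"
      using Ls(3)[OF x(1)] x(2) by (simp add: h'_def)
    then obtain S where S: "S \<in> set Ls" "x \<in> S" by (auto split: if_splits)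
    then obtain A B where AB: "Ls = A @ S # B" by (meson split_list)
    have pos: "h' v \<ge> 1" if "v \<in> S" for v
    proof -
      have "v \<in> verts G" using that S(1) Ls(2) unfolding independent_set_def by blast
      from Ls(3)[OF this] show ?thesis using that by (simp add: AB)
    qed
    \<comment> \<open>The weight \<open>h''\<close> is chosen so that adding \<open>S\<close> as one
      more class gives back \<open>h\<close>: at \<open>x\<close>, the set \<open>S\<close> covers
      the copy dropped in \<open>h'\<close>. By \<open>pos\<close> the subtraction does not
      truncate.\<close>
    define h'' where "h'' v = h' v - of_bool (v \<in> S - {x})" for v
    have le'': "h'' v \<le> h' v" for v by (simp add: h''_def)
    have bound: "sum h'' K \<le> m - 1" if K: "clique G K" for K
    proof -
      have fin: "finite K" using finite_clique[OF finite_verts K] .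
      \<comment> \<open>A clique through \<open>S - {x}\<close> loses weight in \<open>h''\<close>,
        and one through \<open>x\<close> has already lost it in \<open>h'\<close>. One avoiding
        \<open>S\<close> is counted by the other classes, at most \<open>m - 1\<close> in number,
        each meeting it at most once.\<close>
      consider (meet) y where "y \<in> K" "y \<in> S - {x}" | (x) "x \<in> K"
        | (disjoint) "K \<inter> S = {}" by blast
      then show ?thesis
      proof cases
        case meet
        have "sum h'' K < sum h' K"
          using meet pos[of y] le'' fin
          by (intro sum_strict_mono_ex1) (auto simp: h''_def intro!: bexI[of _ y])
        also have "\<dots> \<le> sum h K" using le by (intro sum_mono) auto
        finally show ?thesis using less.prems[OF K] by simp
      next
        case x
        have "sum h'' K \<le> sum h' K" using le'' by (intro sum_mono) auto
        also have "\<dots> < sum h K" using lt x fin by blast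
        finally show ?thesis using less.prems[OF K] by simp
      next
        case disjoint
        have "sum h'' K \<le> sum h' K" using le'' by (intro sum_mono) auto
        also have "\<dots> = (\<Sum>v\<in>K. \<Sum>T\<leftarrow>Ls. of_bool (v \<in> T))"
          using K Ls(3) by (intro sum.cong) (auto simp: clique_def)
        also have "\<dots> = (\<Sum>T\<leftarrow>A @ B. card (K \<inter> T))"
          using sum_sum_list_of_bool[OF fin, of Ls] disjoint by (simp add: AB)
        also have "\<dots> \<le> (\<Sum>T\<leftarrow>A @ B. 1)"
          using card_clique_Int_independent_set_le_1[OF K Ls(2)]
          by (intro sum_list_mono) (auto simp: AB)
        also have "\<dots> \<le> m - 1" using Ls(1) by (simp add: AB sum_list_triv)
        finally show ?thesis .
      qed
    qed
    have "sum h'' (verts G) \<le> sum h' (verts G)" using le'' by (intro sum_mono) auto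
    also have "\<dots> < sum h (verts G)" using lt x(1) by simp
    finally obtain Ms where Ms: "length Ms \<le> m - 1" "\<forall>S\<in>set Ms. independent_set G S"
        "\<And>v. v \<in> verts G \<Longrightarrow> (\<Sum>S\<leftarrow>Ms. of_bool (v \<in> S)) = h'' v"
      using less.hyps[OF _ bound] by blast
    have "(\<Sum>S\<leftarrow>S # Ms. of_bool (v \<in> S)) = h v" if "v \<in> verts G" for v
      using Ms(3)[OF that] pos[of v] S(2) x(2) by (auto simp: h''_def h'_def)
    moreover have "length (S # Ms) \<le> m" using Ms(1) Ls(1) AB by simp
    ultimately show ?thesis using Ms(2) Ls(2) S(1) by (intro exI[of _ "S # Ms"]) auto
  qed
qed

text \<open>Supplies the clique to split off: without it, \<open>W\<close> has no independent set of
  size \<open>m\<close> left.\<close>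

lemma (in graph) perfect_clique_transversal:
  assumes perf: "perfect_graph G" and W: "W \<subseteq> verts G" "W \<noteq> {}"
    and m: "\<And>S. independent_set G S \<Longrightarrow> S \<subseteq> W \<Longrightarrow> card S \<le> m"
  shows "\<exists>K. clique G K \<and> K \<subseteq> W \<and> K \<noteq> {} \<and>
    (\<forall>S. independent_set G S \<longrightarrow> S \<subseteq> W \<longrightarrow> card S = m \<longrightarrow> K \<inter> S \<noteq> {})"
proof (rule ccontr)
  assume contra: "\<not> ?thesis"
  have fW: "finite W" using W(1) finite_verts finite_subset by blast
  obtain w where w: "w \<in> W" using W(2) by blast
  have "independent_set G {w}"
    using w W(1) not_dominates_self by (auto simp: independent_set_def)
  then have m1: "m \<ge> 1" using m[of "{w}"] w by simp
  define Q where "Q = {K. clique G K \<and> K \<subseteq> W \<and> K \<noteq> {}}"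
  have "{w} \<in> Q" using w W(1) by (auto simp: Q_def clique_def)
  moreover have fQ: "finite Q" by (simp add: Q_def finite_cliques)
  ultimately have Q0: "card Q > 0" by (auto simp: card_gt_0_iff)
  have "\<exists>S. independent_set G S \<and> S \<subseteq> W \<and> card S = m \<and> K \<inter> S = {}" if "K \<in> Q" for K
    using that contra unfolding Q_def by blast
  then obtain \<sigma> where \<sigma>: "\<And>K. K \<in> Q \<Longrightarrow> independent_set G (\<sigma> K)" "\<And>K. K \<in> Q \<Longrightarrow> \<sigma> K \<subseteq> W"
      "\<And>K. K \<in> Q \<Longrightarrow> card (\<sigma> K) = m" "\<And>K. K \<in> Q \<Longrightarrow> K \<inter> \<sigma> K = {}"
    by metis
  define h where "h v = (\<Sum>K\<in>Q. of_bool (v \<in> \<sigma> K) :: nat)" for v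
  have sum_h: "sum h X = (\<Sum>K\<in>Q. card (X \<inter> \<sigma> K))" if "finite X" for X
    unfolding h_def using that by (subst sum.swap) (simp flip: sum.inter_restrict)
  have bound: "sum h X \<le> card Q - 1" if X: "clique G X" for X
  proof -
    have fX: "finite X" using finite_clique[OF finite_verts X] .
    have XW: "clique G (X \<inter> W)" using X by (auto simp: clique_def)
    have "card (X \<inter> \<sigma> K) \<le> 1" if "K \<in> Q" for K
      using card_clique_Int_independent_set_le_1[OF X \<sigma>(1)[OF that]] .
    \<comment> \<open>The strict term comes from the set chosen for \<open>X \<inter> W\<close>,
      which misses \<open>X\<close>. If \<open>X\<close> avoids \<open>W\<close>, every chosen set
      misses \<open>X\<close>, and \<open>{w}\<close> serves as index.\<close>
    moreover have "\<exists>K\<in>Q. card (X \<inter> \<sigma> K) < 1"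
    proof (cases "X \<inter> W = {}")
      case True
      then have "X \<inter> \<sigma> {w} = {}" using \<sigma>(2) \<open>{w} \<in> Q\<close> by blast
      then show ?thesis using \<open>{w} \<in> Q\<close> by (metis card.empty zero_less_one)
    next
      case False
      then have "X \<inter> W \<in> Q" using XW by (auto simp: Q_def)
      moreover from this have "X \<inter> \<sigma> (X \<inter> W) = {}" using \<sigma>(2,4) by blast
      ultimately show ?thesis by (metis card.empty zero_less_one)
    qed
    ultimately have "sum h X < (\<Sum>K\<in>Q. 1)"
      unfolding sum_h[OF fX] using fQ by (intro sum_strict_mono_ex1) auto
    then show ?thesis by simp
  qed
  obtain Ls where Ls: "length Ls \<le> card Q - 1" "\<And>S. S \<in> set Ls \<Longrightarrow> independent_set G S"
      "\<And>v. v \<in> verts G \<Longrightarrow> (\<Sum>S\<leftarrow>Ls. of_bool (v \<in> S)) = h v"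
    using perfect_weighted_colouring[OF perf bound] by blast
  \<comment> \<open>The total weight on \<open>W\<close> is counted twice: through the
    \<open>card Q\<close> chosen sets of size \<open>m\<close>, and through at most
    \<open>card Q - 1\<close> independent sets of size at most \<open>m\<close>. As \<open>m\<close>
    is positive, these disagree.\<close>
  have "card Q * m = (\<Sum>K\<in>Q. card (W \<inter> \<sigma> K))"
    using \<sigma>(2,3) by (simp add: Int_absorb1)
  also have "\<dots> = (\<Sum>v\<in>W. \<Sum>S\<leftarrow>Ls. of_bool (v \<in> S))"
    using Ls(3) W(1) by (subst sum_h[OF fW, symmetric]) (auto intro!: sum.cong)
  also have "\<dots> = (\<Sum>S\<leftarrow>Ls. card (W \<inter> S))" by (rule sum_sum_list_of_bool[OF fW])
  also have "\<dots> \<le> (\<Sum>S\<leftarrow>Ls. m)"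
    using Ls(2) by (intro sum_list_mono m) (auto intro: independent_set_subset)
  also have "\<dots> \<le> (card Q - 1) * m" using Ls(1) by (simp add: sum_list_triv)
  finally show False using Q0 m1 by simp
qed

text \<open>Splitting off a clique that meets every independent set of size \<open>m\<close> lowers
  the bound by one, so induction on \<open>W\<close> yields at most \<open>m\<close>
  cliques.\<close>

lemma (in graph) perfect_clique_partition:
  assumes perf: "perfect_graph G" and "W \<subseteq> verts G"
    and "\<And>S. independent_set G S \<Longrightarrow> S \<subseteq> W \<Longrightarrow> card S \<le> m"
  shows "\<exists>P. partition_on W P \<and> (\<forall>C\<in>P. clique G C) \<and> card P \<le> m"
  using assms(2,3)
proof (induction "card W" arbitrary: W m rule: less_induct)
  case less
  show ?case
  proof (cases "W = {}")
    case True
    then show ?thesis by (intro exI[of _ "{}"]) (auto simp: partition_on_empty)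
  next
    case False
    obtain K where K: "clique G K" "K \<subseteq> W" "K \<noteq> {}"
      "\<And>S. independent_set G S \<Longrightarrow> S \<subseteq> W \<Longrightarrow> card S = m \<Longrightarrow> K \<inter> S \<noteq> {}"
      using perfect_clique_transversal[OF perf less.prems(1) False less.prems(2)] by blast
    have fW: "finite W" using less.prems(1) finite_verts finite_subset by blast
    \<comment> \<open>For \<open>m = 0\<close> the empty set would be an independent set of size
      \<open>m\<close>, and no clique meets it.\<close>
    have "m \<ge> 1"
      using K(4)[of "{}"] independent_set_empty[of G] by (cases m) auto
    have "card S \<le> m - 1" if "independent_set G S" "S \<subseteq> W - K" for S
    proof -
      have "S \<subseteq> W" "K \<inter> S = {}" using that(2) by auto
      then have "card S \<le> m" "card S \<noteq> m"
        using less.prems(2)[OF that(1)] K(4)[OF that(1)] by auto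
      then show ?thesis by simp
    qed
    moreover have "card (W - K) < card W"
      using K(2,3) fW by (intro psubset_card_mono) auto
    ultimately obtain P where P: "partition_on (W - K) P" "\<forall>C\<in>P. clique G C" "card P \<le> m - 1"
      using less.hyps[of "W - K" "m - 1"] less.prems(1) by blast
    have "partition_on W (insert K P)"
      using P(1) K(2,3) by (subst partition_on_insert) (auto simp: partition_on_def disjnt_def)
    moreover have "card (insert K P) \<le> m"
      using P(3) \<open>m \<ge> 1\<close> by (intro card_insert_le_m1) auto
    ultimately show ?thesis using P(2) K(1) by (intro exI[of _ "insert K P"]) auto
  qed
qed

text \<open>The two numbers are the chromatic and the clique number of the complement; this form
  avoids constructing the complement.\<close>

theorem (in graph) perfect_clique_cover_number:
  assumes "perfect_graph G"
  shows "clique_cover_number G = independence_number G"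
proof (rule antisym)
  show "clique_cover_number G \<le> independence_number G"
    using perfect_clique_partition[OF assms order_refl card_independent_set_le[OF finite_verts]]
      clique_cover_number_le order_trans by blast
  show "independence_number G \<le> clique_cover_number G"
    using independence_number_attained[OF finite_verts] clique_cover_number_attained
      independence_le_clique_cover by metis
qed

section \<open>The forbidden hexagons\<close>

lemma contains_inducedI:
  fixes f :: "'c \<Rightarrow> 'a" and G :: "('a, 'b) pre_digraph"
  assumes "graph G" and inj: "inj_on f (pverts P)" and sub: "f ` pverts P \<subseteq> verts G"
    and wf: "parcs P \<subseteq> pverts P \<times> pverts P"
    and arcs: "\<And>u v. u \<in> pverts P \<Longrightarrow> v \<in> pverts P \<Longrightarrow> f u \<rightarrow>\<^bsub>G\<^esub> f v \<longleftrightarrow> (u, v) \<in> parcs P"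
  shows "contains_induced G (with_proj P)"
proof -
  interpret graph G by fact
  let ?H = "G \<restriction> (f ` pverts P)"
  let ?g = "the_inv_into (pverts P) f"
  \<comment> \<open>The isomorphism runs from the induced subgraph to the pattern, hence the inverse
    of \<open>f\<close>. An arc goes to the pair of its relabelled ends, which is injective because
    there are no parallel arcs.\<close>
  let ?i = "\<lparr>iso_verts = ?g, iso_arcs = \<lambda>e. (?g (tail G e), ?g (head G e)),
    iso_head = snd, iso_tail = fst\<rparr>"
  have g: "?g (f u) = u" if "u \<in> pverts P" for u using the_inv_into_f_f[OF inj that] .
  have g_inj: "inj_on ?g (f ` pverts P)" using inj_on_the_inv_into[OF inj] .
  have arcs_inj: "inj_on (\<lambda>e. (?g (tail G e), ?g (head G e))) (arcs ?H)"
  proof (rule inj_onI)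
    fix d e assume "d \<in> arcs ?H" "e \<in> arcs ?H"
      "(?g (tail G d), ?g (head G d)) = (?g (tail G e), ?g (head G e))"
    moreover from this have "tail G d = tail G e" "head G d = head G e"
      using g_inj by (auto dest: inj_onD)
    ultimately show "d = e" using no_multi_arcs by (auto simp: arc_to_ends_def)
  qed
  have iso: "pre_digraph.digraph_isomorphism ?H ?i"
    unfolding pre_digraph.digraph_isomorphism_def using g_inj arcs_inj by auto
  have "(\<lambda>e. (?g (tail G e), ?g (head G e))) ` arcs ?H = parcs P"
  proof (intro set_eqI iffI)
    fix p assume "p \<in> (\<lambda>e. (?g (tail G e), ?g (head G e))) ` arcs ?H"
    then obtain e u v where e: "e \<in> arcs G" "tail G e = f u" "head G e = f v" "u \<in> pverts P"
        "v \<in> pverts P" "p = (?g (tail G e), ?g (head G e))"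
      by auto
    then have "f u \<rightarrow>\<^bsub>G\<^esub> f v" by (metis in_arcs_imp_in_arcs_ends)
    then show "p \<in> parcs P" using e arcs g by simp
  next
    fix p assume p: "p \<in> parcs P"
    obtain u v where uv: "p = (u, v)" "u \<in> pverts P" "v \<in> pverts P" using p wf by auto
    then have "f u \<rightarrow>\<^bsub>G\<^esub> f v" using arcs p by simp
    then obtain e where "e \<in> arcs G" "tail G e = f u" "head G e = f v"
      by (auto simp: arcs_ends_conv)
    then show "p \<in> (\<lambda>e. (?g (tail G e), ?g (head G e))) ` arcs ?H"
      using uv g by (intro rev_image_eqI[of e]) auto
  qed
  moreover have "?g ` f ` pverts P = pverts P" using g by (auto simp: image_iff)
  ultimately have "with_proj P = app_iso ?i ?H"
    by (simp add: app_iso_def with_proj_def)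
  then have "digraph_iso ?H (with_proj P)" using iso unfolding digraph_iso_def by blast
  moreover have "induced_subgraph ?H G" using sub by (rule induced_induce)
  ultimately show ?thesis unfolding contains_induced_def by blast
qed

text \<open>A 6-cycle in cyclic order, with \<open>x\<close>, \<open>y\<close>, \<open>z\<close>
  opposite \<open>a\<close>, \<open>b\<close>, \<open>c\<close>. Adjacency among \<open>x\<close>,
  \<open>y\<close>, \<open>z\<close> is left open, so that one predicate covers all four forbidden
  graphs.\<close>

definition hexagon :: "('a, 'b) pre_digraph \<Rightarrow> 'a \<Rightarrow> 'a \<Rightarrow> 'a \<Rightarrow> 'a \<Rightarrow> 'a \<Rightarrow> 'a \<Rightarrow> bool" where
  "hexagon G x c y a z b \<longleftrightarrow>
    distinct [x, c, y, a, z, b] \<and>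
    x \<rightarrow>\<^bsub>G\<^esub> c \<and> c \<rightarrow>\<^bsub>G\<^esub> y \<and> y \<rightarrow>\<^bsub>G\<^esub> a \<and> a \<rightarrow>\<^bsub>G\<^esub> z \<and> z \<rightarrow>\<^bsub>G\<^esub> b \<and> b \<rightarrow>\<^bsub>G\<^esub> x \<and>
    \<not> x \<rightarrow>\<^bsub>G\<^esub> a \<and> \<not> y \<rightarrow>\<^bsub>G\<^esub> b \<and> \<not> z \<rightarrow>\<^bsub>G\<^esub> c \<and>
    \<not> a \<rightarrow>\<^bsub>G\<^esub> b \<and> \<not> b \<rightarrow>\<^bsub>G\<^esub> c \<and> \<not> c \<rightarrow>\<^bsub>G\<^esub> a"

lemma hexagon_contains_C6_with:
  assumes "graph G" and hex: "hexagon G x c y a z b"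
    and E: "E \<subseteq> {(0,2), (2,4), (4,0)}"
    "x \<rightarrow>\<^bsub>G\<^esub> y \<longleftrightarrow> (0,2) \<in> E" "y \<rightarrow>\<^bsub>G\<^esub> z \<longleftrightarrow> (2,4) \<in> E" "z \<rightarrow>\<^bsub>G\<^esub> x \<longleftrightarrow> (4,0) \<in> E"
  shows "contains_induced G (C6_with E)"
proof -
  interpret graph G by fact
  let ?P = "\<lparr>pverts = {0, 1, 2, 3, 4, 5::nat},
    parcs = (C6_edges \<union> E) \<union> (C6_edges \<union> E)\<inverse>\<rparr>"
  \<comment> \<open>Cyclic order puts \<open>x\<close>, \<open>y\<close>, \<open>z\<close> at
    positions 0, 2, 4, where \<open>C6_with\<close> adds its edges.\<close>
  let ?f = "\<lambda>i::nat. [x, c, y, a, z, b] ! i"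
  have E_iff: "(i, j) \<in> E \<longleftrightarrow> (i, j) = (0,2) \<and> x \<rightarrow>\<^bsub>G\<^esub> y \<or> (i, j) = (2,4) \<and> y \<rightarrow>\<^bsub>G\<^esub> z
      \<or> (i, j) = (4,0) \<and> z \<rightarrow>\<^bsub>G\<^esub> x" for i j
    using E by auto
  have verts: "{x, c, y, a, z, b} \<subseteq> verts G"
    using hex adj_in_verts unfolding hexagon_def by blast
  have sym: "y \<rightarrow>\<^bsub>G\<^esub> x \<longleftrightarrow> x \<rightarrow>\<^bsub>G\<^esub> y" "z \<rightarrow>\<^bsub>G\<^esub> y \<longleftrightarrow> y \<rightarrow>\<^bsub>G\<^esub> z" "x \<rightarrow>\<^bsub>G\<^esub> z \<longleftrightarrow> z \<rightarrow>\<^bsub>G\<^esub> x"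
    using dominates_sym by blast+
  have hex': "c \<rightarrow>\<^bsub>G\<^esub> x" "y \<rightarrow>\<^bsub>G\<^esub> c" "a \<rightarrow>\<^bsub>G\<^esub> y" "z \<rightarrow>\<^bsub>G\<^esub> a" "b \<rightarrow>\<^bsub>G\<^esub> z" "x \<rightarrow>\<^bsub>G\<^esub> b"
    "\<not> a \<rightarrow>\<^bsub>G\<^esub> x" "\<not> b \<rightarrow>\<^bsub>G\<^esub> y" "\<not> c \<rightarrow>\<^bsub>G\<^esub> z" "\<not> b \<rightarrow>\<^bsub>G\<^esub> a" "\<not> c \<rightarrow>\<^bsub>G\<^esub> b" "\<not> a \<rightarrow>\<^bsub>G\<^esub> c"
    using hex dominates_sym unfolding hexagon_def by blast+
  show ?thesis
    unfolding C6_with_def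
  proof (rule contains_inducedI[OF assms(1), where f = ?f])
    show "inj_on ?f (pverts ?P)"
      using hex by (intro inj_on_nth) (auto simp: hexagon_def)
  next
    fix i j assume "i \<in> pverts ?P" "j \<in> pverts ?P"
    then show "?f i \<rightarrow>\<^bsub>G\<^esub> ?f j \<longleftrightarrow> (i, j) \<in> parcs ?P"
      unfolding pair_pre_digraph.simps insert_iff empty_iff
      by (elim disjE FalseE; simp add: hex[unfolded hexagon_def] hex' sym not_dominates_self
          C6_edges_def E_iff)
  next
    show "?f ` pverts ?P \<subseteq> verts G" using verts by simp
  next
    have "C6_edges \<union> {(0,2), (2,4), (4,0)} \<subseteq> {0, 1, 2, 3, 4, 5} \<times> {0, 1, 2, 3, 4, 5}"
      by (simp add: C6_edges_def)
    then have "C6_edges \<union> E \<subseteq> {0, 1, 2, 3, 4, 5} \<times> {0, 1, 2, 3, 4, 5}"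
      using E(1) by blast
    then show "parcs ?P \<subseteq> pverts ?P \<times> pverts ?P"
      unfolding pair_pre_digraph.simps by blast
  qed
qed

text \<open>Rotation by two positions permutes \<open>x\<close>, \<open>y\<close>, \<open>z\<close>
  cyclically.\<close>

lemma hexagon_rotate: "hexagon G x c y a z b \<Longrightarrow> hexagon G y a z b x c"
  unfolding hexagon_def by auto

text \<open>The presence of the edges \<open>xy\<close>, \<open>yz\<close>, \<open>zx\<close> is a
  cyclic binary word of length three. Some rotation puts the present edges first, and the four words
  of that shape are the four forbidden graphs.\<close>

lemma no_hexagon:
  assumes "graph G" and free: "\<forall>F\<in>forbidden_graphs. \<not> contains_induced G F"
  shows "\<not> hexagon G x c y a z b"
proof
  interpret graph G by fact
  assume hex: "hexagon G x c y a z b"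
  have F: "C6_with {} \<in> forbidden_graphs" "C6_with {(0,2)} \<in> forbidden_graphs"
    "C6_with {(0,2), (2,4)} \<in> forbidden_graphs" "C6_with {(0,2), (2,4), (4,0)} \<in> forbidden_graphs"
    by (auto simp: forbidden_graphs_def)
  have no: False
    if hex: "hexagon G x c y a z b" and pattern: "x \<rightarrow>\<^bsub>G\<^esub> y \<or> \<not> y \<rightarrow>\<^bsub>G\<^esub> z" "y \<rightarrow>\<^bsub>G\<^esub> z \<or> \<not> z \<rightarrow>\<^bsub>G\<^esub> x" for x c y a z b
  proof -
    note contains = hexagon_contains_C6_with[OF assms(1) hex]
    consider "\<not> x \<rightarrow>\<^bsub>G\<^esub> y" "\<not> y \<rightarrow>\<^bsub>G\<^esub> z" "\<not> z \<rightarrow>\<^bsub>G\<^esub> x" | "x \<rightarrow>\<^bsub>G\<^esub> y" "\<not> y \<rightarrow>\<^bsub>G\<^esub> z" "\<not> z \<rightarrow>\<^bsub>G\<^esub> x"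
      | "x \<rightarrow>\<^bsub>G\<^esub> y" "y \<rightarrow>\<^bsub>G\<^esub> z" "\<not> z \<rightarrow>\<^bsub>G\<^esub> x" | "x \<rightarrow>\<^bsub>G\<^esub> y" "y \<rightarrow>\<^bsub>G\<^esub> z" "z \<rightarrow>\<^bsub>G\<^esub> x"
      using pattern by blast
    then show False
    proof cases
      case 1 then show ?thesis using contains[of "{}"] free F(1) by auto
    next
      case 2 then show ?thesis using contains[of "{(0,2)}"] free F(2) by auto
    next
      case 3 then show ?thesis using contains[of "{(0,2), (2,4)}"] free F(3) by auto
    next
      case 4 then show ?thesis using contains[of "{(0,2), (2,4), (4,0)}"] free F(4) by auto
    qed
  qed
  show False
    using no[OF hex] no[OF hexagon_rotate[OF hex]]
      no[OF hexagon_rotate[OF hexagon_rotate[OF hex]]] by blast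
qed

section \<open>The auxiliary graph\<close>

lemma verts_auxiliary_graph: "verts (auxiliary_graph G) = verts G"
  by (simp add: auxiliary_graph_def)

lemma dominates_auxiliary_graph:
  assumes "graph G"
  shows "u \<rightarrow>\<^bsub>auxiliary_graph G\<^esub> v \<longleftrightarrow> u \<noteq> v \<and> \<not> u \<rightarrow>\<^bsub>G\<^esub> v \<and> (\<exists>w. u \<rightarrow>\<^bsub>G\<^esub> w \<and> w \<rightarrow>\<^bsub>G\<^esub> v)"
proof -
  interpret graph G by fact
  have "u \<rightarrow>\<^bsub>auxiliary_graph G\<^esub> v \<longleftrightarrow> u \<in> verts G \<and> v \<in> verts G \<and> graph_dist G u v = 2"
    by (auto simp: auxiliary_graph_def arcs_ends_def arc_to_ends_def image_iff)
  then show ?thesis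
    unfolding graph_dist_eq_2_iff[OF assms] using adj_in_verts by blast
qed

lemma separated_cluster_number_eq:
  assumes "graph G"
  shows "separated_cluster_number G = independence_number (auxiliary_graph G)"
proof -
  have "separated_cluster G = independent_set (auxiliary_graph G)"
    unfolding separated_cluster_def independent_set_def graph_dist_eq_2_iff[OF assms]
      dominates_auxiliary_graph[OF assms] verts_auxiliary_graph by blast
  then show ?thesis by (simp add: separated_cluster_number_def independence_number_def)
qed

text \<open>
  A minimal counterexample \<open>S\<close> has three vertices \<open>a\<close>, \<open>b\<close>, \<open>c\<close>; common neighbours \<open>x\<close>, \<open>y\<close>, \<open>z\<close>
  of \<open>S\<close> minus \<open>a\<close>, \<open>b\<close>, \<open>c\<close> respectively then close up to a hexagon.
\<close>

lemma auxiliary_clique_common_neighbour: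
  assumes "graph G" and free: "\<forall>F\<in>forbidden_graphs. \<not> contains_induced G F"
    and "clique (auxiliary_graph G) S" "S \<noteq> {}"
  shows "\<exists>v\<in>verts G. S \<subseteq> closed_neighbourhood G v"
proof -
  interpret graph G by fact
  note dom = dominates_auxiliary_graph[OF assms(1)]
  \<comment> \<open>For at least two vertices the induction gives an open neighbourhood; a single
    vertex is dominated by itself and is treated at the end.\<close>
  have common: "\<exists>w. \<forall>s\<in>S. w \<rightarrow>\<^bsub>G\<^esub> s"
    if "clique (auxiliary_graph G) S" "2 \<le> card S" for S
    using that
  proof (induction "card S" arbitrary: S rule: less_induct)
    case less
    have fS: "finite S" using less.prems(2) by (auto intro: card_ge_0_finite)
    have nonadj: "u \<noteq> v \<Longrightarrow> \<not> u \<rightarrow>\<^bsub>G\<^esub> v" if "u \<in> S" "v \<in> S" for u v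
      using less.prems(1) that unfolding clique_def dom by blast
    show ?case
    proof (cases "card S = 2")
      case True
      then obtain u v where uv: "S = {u, v}" "u \<noteq> v" by (auto simp: card_2_iff)
      then have "\<exists>w. u \<rightarrow>\<^bsub>G\<^esub> w \<and> w \<rightarrow>\<^bsub>G\<^esub> v"
        using less.prems(1) unfolding clique_def dom by blast
      then show ?thesis using uv dominates_sym by blast
    next
      case False
      then have "card S \<ge> 3" using less.prems(2) by simp
      then obtain T where "T \<subseteq> S" "card T = 3" by (meson obtain_subset_with_card_n)
      then obtain a b c where abc: "a \<in> S" "b \<in> S" "c \<in> S" "a \<noteq> b" "b \<noteq> c" "c \<noteq> a"
        by (auto simp: card_3_iff)
      show ?thesis
      proof (rule ccontr)
        assume none: "\<not> ?thesis"
        \<comment> \<open>A common neighbour of \<open>S - {s}\<close> exists by induction; it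
          misses \<open>s\<close>, since otherwise it would dominate all of
          \<open>S\<close>.\<close>
        have almost: "\<exists>w. \<not> w \<rightarrow>\<^bsub>G\<^esub> s \<and> (\<forall>t\<in>S - {s}. w \<rightarrow>\<^bsub>G\<^esub> t)" if "s \<in> S" for s
        proof -
          have "clique (auxiliary_graph G) (S - {s})"
            using less.prems(1) unfolding clique_def by blast
          moreover have "card (S - {s}) < card S" "2 \<le> card (S - {s})"
            using that fS \<open>card S \<ge> 3\<close> by auto
          ultimately obtain w where "\<forall>t\<in>S - {s}. w \<rightarrow>\<^bsub>G\<^esub> t" using less.hyps by blast
          then show ?thesis using none by blast
        qed
        obtain x y z where xyz: "\<not> x \<rightarrow>\<^bsub>G\<^esub> a" "\<forall>t\<in>S - {a}. x \<rightarrow>\<^bsub>G\<^esub> t"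
          "\<not> y \<rightarrow>\<^bsub>G\<^esub> b" "\<forall>t\<in>S - {b}. y \<rightarrow>\<^bsub>G\<^esub> t" "\<not> z \<rightarrow>\<^bsub>G\<^esub> c" "\<forall>t\<in>S - {c}. z \<rightarrow>\<^bsub>G\<^esub> t"
          using almost abc(1-3) by meson
        then have adj: "x \<rightarrow>\<^bsub>G\<^esub> b" "x \<rightarrow>\<^bsub>G\<^esub> c" "y \<rightarrow>\<^bsub>G\<^esub> a" "y \<rightarrow>\<^bsub>G\<^esub> c" "z \<rightarrow>\<^bsub>G\<^esub> a" "z \<rightarrow>\<^bsub>G\<^esub> b"
          using abc by blast+
        \<comment> \<open>\<open>S\<close> is independent in \<open>G\<close>, so a neighbour of one
          of \<open>a\<close>, \<open>b\<close>, \<open>c\<close> is none of them.\<close>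
        have ne: "w \<notin> {a, b, c}" if "w \<rightarrow>\<^bsub>G\<^esub> s" "s \<in> {a, b, c}" for w s
          using that nonadj abc(1-3) not_dominates_self by blast
        have "x \<notin> {a, b, c}" "y \<notin> {a, b, c}" "z \<notin> {a, b, c}" using ne adj by blast+
        moreover have "x \<noteq> y" "y \<noteq> z" "z \<noteq> x" using adj xyz by blast+
        ultimately have "distinct [x, c, y, a, z, b]" using abc by auto
        moreover have "c \<rightarrow>\<^bsub>G\<^esub> y" "a \<rightarrow>\<^bsub>G\<^esub> z" "b \<rightarrow>\<^bsub>G\<^esub> x"
          using adj(1,4,5) dominates_sym by blast+
        moreover have "\<not> a \<rightarrow>\<^bsub>G\<^esub> b" "\<not> b \<rightarrow>\<^bsub>G\<^esub> c" "\<not> c \<rightarrow>\<^bsub>G\<^esub> a"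
          using nonadj abc by blast+
        ultimately have "hexagon G x c y a z b"
          unfolding hexagon_def using adj(2,3,6) xyz(1,3,5) by simp
        then show False using no_hexagon[OF assms(1) free] by blast
      qed
    qed
  qed
  have sub: "S \<subseteq> verts G"
    using assms(3) unfolding clique_def verts_auxiliary_graph by blast
  show ?thesis
  proof (cases "2 \<le> card S")
    case True
    then obtain w where w: "\<forall>s\<in>S. w \<rightarrow>\<^bsub>G\<^esub> s" using common assms(3) by blast
    then have "w \<in> verts G" using assms(4) adj_in_verts by blast
    then show ?thesis using w unfolding closed_neighbourhood_def by blast
  next
    case False
    moreover have "card S \<noteq> 0"
      using assms(4) sub finite_subset[OF _ finite_verts] by auto
    ultimately have "card S = 1" by simp
    then obtain s where "S = {s}" by (auto simp: card_1_singleton_iff)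
    then show ?thesis using sub by (auto simp: closed_neighbourhood_def)
  qed
qed

section \<open>Cd-colourings of \<open>G\<close> and clique partitions of its auxiliary
  graph\<close>

lemma cd_colour_class_clique:
  assumes "graph G" "cd_colouring G c" "i \<in> c ` verts G"
  shows "clique (auxiliary_graph G) (colour_class G c i)"
proof -
  interpret graph G by fact
  obtain w where w: "colour_class G c i \<subseteq> closed_neighbourhood G w"
    using assms(2,3) unfolding cd_colouring_def by blast
  have nonadj: "\<not> u \<rightarrow>\<^bsub>G\<^esub> v" if "u \<in> colour_class G c i" "v \<in> colour_class G c i" for u v
    using that assms(2) unfolding cd_colouring_def proper_colouring_def colour_class_def by force
  \<comment> \<open>If \<open>u\<close> or \<open>v\<close> were \<open>w\<close>, the other would
    be a neighbour of \<open>w\<close> in the same class, against properness. So \<open>w\<close> is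
    a common neighbour of both.\<close>
  have "u \<rightarrow>\<^bsub>auxiliary_graph G\<^esub> v"
    if "u \<in> colour_class G c i" "v \<in> colour_class G c i" "u \<noteq> v" for u v
    unfolding dominates_auxiliary_graph[OF assms(1)]
    using that w nonadj dominates_sym unfolding closed_neighbourhood_def by blast
  then show ?thesis
    unfolding clique_def verts_auxiliary_graph by (auto simp: colour_class_def)
qed

text \<open>The parts are numbered injectively and serve as colour classes. Vertices of one part are
  nonadjacent in \<open>G\<close>, which gives properness; the Helly property gives the dominating
  vertex.\<close>

lemma cd_colouring_of_clique_partition:
  assumes "graph G" and free: "\<forall>F\<in>forbidden_graphs. \<not> contains_induced G F"
    and P: "partition_on (verts G) P" "\<forall>C\<in>P. clique (auxiliary_graph G) C"
  shows "\<exists>c. cd_colouring G c \<and> card (c ` verts G) = card P"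
proof -
  interpret graph G by fact
  have "finite P" using finite_elements[OF finite_verts P(1)] .
  then obtain e :: "'a set \<Rightarrow> nat" where e: "inj_on e P"
    using finite_imp_inj_to_nat_seg by blast
  define part where "part v = (THE C. C \<in> P \<and> v \<in> C)" for v
  have part: "C \<in> P \<Longrightarrow> v \<in> C \<Longrightarrow> part v = C" for C v
    unfolding part_def using P(1) by (intro the_equality) (auto simp: partition_on_def disjoint_def)
  have cover: "\<exists>C\<in>P. v \<in> C" if "v \<in> verts G" for v
    using that P(1) by (auto simp: partition_on_def)
  have subset: "C \<subseteq> verts G" "C \<noteq> {}" if "C \<in> P" for C
    using that P(1) by (auto simp: partition_on_def)
  define c where "c v = e (part v)" for v
  have "part ` verts G = P"
  proof (intro set_eqI iffI)
    fix C assume "C \<in> part ` verts G" then show "C \<in> P" using cover part by blast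
  next
    fix C assume C: "C \<in> P"
    then obtain v where "v \<in> C" using subset by blast
    then show "C \<in> part ` verts G" using C part subset by blast
  qed
  then have range: "c ` verts G = e ` P" unfolding c_def by blast
  have c_class: "colour_class G c (e C) = C" if "C \<in> P" for C
  proof (intro set_eqI iffI)
    fix v assume "v \<in> colour_class G c (e C)"
    then have v: "v \<in> verts G" "e (part v) = e C" by (auto simp: colour_class_def c_def)
    obtain D where "D \<in> P" "v \<in> D" using cover v(1) by blast
    then show "v \<in> C" using part v(2) e that by (metis inj_onD)
  next
    fix v assume "v \<in> C"
    then show "v \<in> colour_class G c (e C)"
      using that part subset by (auto simp: colour_class_def c_def)
  qed
  have "c u \<noteq> c v" if "u \<rightarrow>\<^bsub>G\<^esub> v" for u v
  proof
    assume "c u = c v"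
    have uv: "u \<in> verts G" "v \<in> verts G" "u \<noteq> v"
      using that adj_in_verts not_dominates_self by blast+
    then obtain C where C: "C \<in> P" "u \<in> C" using cover by blast
    then have "v \<in> colour_class G c (e C)"
      using \<open>c u = c v\<close> uv part by (simp add: colour_class_def c_def)
    then have "v \<in> C" using c_class C(1) by blast
    then have "u \<rightarrow>\<^bsub>auxiliary_graph G\<^esub> v" using P(2) C uv(3) unfolding clique_def by blast
    then show False using that unfolding dominates_auxiliary_graph[OF assms(1)] by blast
  qed
  moreover have "\<exists>v\<in>verts G. C \<subseteq> closed_neighbourhood G v" if "C \<in> P" for C
    using auxiliary_clique_common_neighbour[OF assms(1) free] P(2) subset(2) that by blast
  ultimately have "cd_colouring G c"
    unfolding cd_colouring_def proper_colouring_def range using c_class by auto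
  moreover have "card (c ` verts G) = card P" unfolding range using e by (rule card_image)
  ultimately show ?thesis by blast
qed

lemma cd_chromatic_number_eq:
  assumes "graph G" and free: "\<forall>F\<in>forbidden_graphs. \<not> contains_induced G F"
  shows "cd_chromatic_number G = clique_cover_number (auxiliary_graph G)"
proof (rule antisym)
  interpret graph G by fact
  obtain P where P: "partition_on (verts G) P" "\<forall>C\<in>P. clique (auxiliary_graph G) C"
      "card P = clique_cover_number (auxiliary_graph G)"
    using clique_cover_number_attained[of "auxiliary_graph G"]
    unfolding verts_auxiliary_graph by blast
  have ex: "\<exists>c. cd_colouring G c \<and> card (c ` verts G) = clique_cover_number (auxiliary_graph G)"
    using cd_colouring_of_clique_partition[OF assms P(1,2)] P(3) by simp
  then show "cd_chromatic_number G \<le> clique_cover_number (auxiliary_graph G)"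
    unfolding cd_chromatic_number_def by (rule Least_le)
  obtain c where c: "cd_colouring G c" "card (c ` verts G) = cd_chromatic_number G"
    using LeastI[of "\<lambda>n. \<exists>c. cd_colouring G c \<and> card (c ` verts G) = n", OF ex]
    unfolding cd_chromatic_number_def by blast
  \<comment> \<open>Only colours in use are taken, so no class is empty, as a partition
    requires.\<close>
  let ?Q = "colour_class G c ` c ` verts G"
  have "partition_on (verts G) ?Q"
    by (auto simp: partition_on_def disjoint_def colour_class_def)
  moreover have "\<forall>C\<in>?Q. clique (auxiliary_graph G) C"
    using cd_colour_class_clique[OF assms(1) c(1)] by blast
  ultimately have "clique_cover_number (auxiliary_graph G) \<le> card ?Q"
    by (intro clique_cover_number_le) (simp_all add: verts_auxiliary_graph)
  also have "\<dots> \<le> card (c ` verts G)" by (intro card_image_le) simp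
  finally show "clique_cover_number (auxiliary_graph G) \<le> cd_chromatic_number G"
    unfolding c(2) .
qed

theorem theorem2:
  fixes G :: "('a, 'b) pre_digraph"
  assumes "graph G"
    and "\<forall>F\<in>forbidden_graphs. \<not> contains_induced G F"
  shows "(clique_cover_number (auxiliary_graph G) = independence_number (auxiliary_graph G)
            \<longrightarrow> cd_chromatic_number G = separated_cluster_number G) \<and>
         (perfect_graph (auxiliary_graph G)
            \<longrightarrow> cd_chromatic_number G = separated_cluster_number G)"
  using cd_chromatic_number_eq[OF assms] separated_cluster_number_eq[OF assms(1)]
    graph.perfect_clique_cover_number[OF graph_auxiliary_graph[OF assms(1)]] by simp

end
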